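(* Let $\mathcal{S}=(V,\Sigma,\delta)$ be a finite nondeterministic fuzzy transition system, $u,v\in V$ and $k\in\mathbb{N}$. The degree-computation algorithm described in the context, which computes the degree of $k$-limited similarity between $u$ and $v$, runs in time $O(2k^2|V|^6\cdot|{\longrightarrow}|^2)$, where $|{\longrightarrow}|=\bigvee_{x\in V}|\{p\in\mathcal{R}(V): x\overset{\tau}{\longrightarrow}p\}|$ is the greatest number of transitions from a state.
   Context: Let $\otimes$ be a fixed left-continuous $t$-norm on $[0,1]$: commutative, associative, increasing, with neutral element $1$, and $r\otimes\bigvee_i r_i=\bigvee_i (r\otimes r_i)$. Its residuum is $t\rightarrow r=\bigvee\{s\in[0,1]: s\otimes t\le r\}$. $\wedge,\vee$ (and $\bigwedge,\bigvee$) are min, max (inf, sup) in $[0,1]$; $\mathbb{N}$ contains $0$. Running time counts elementary operations ($\rightarrow$, min, max, comparisons of elements of $[0,1]$) at unit cost. $V$ is a nonempty finite set; $\mathcal{R}(V)$ is the set of fuzzy subsets of $V$ (maps $V\to[0,1]$), also called distributions. For $p\in\mathcal{R}(V)$ and $X\subseteq V$, $p(X)=\bigvee_{x\in X}p(x)$ (with $p(\emptyset)=0$). A nondeterministic fuzzy transition system (NFTS) is a triple $\mathcal{S}=(V,\Sigma,\delta)$ with $\Sigma$ a set of labels and $\delta\subseteq V\times\Sigma\times\mathcal{R}(V)$; $\delta(u,\tau)=\{p:(u,\tau,p)\in\delta\}$, and $u\overset{\tau}{\longrightarrow}p$ means $p\in\delta(u,\tau)$. It is finite if $V$ and $\Sigma$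 are finite and every $\delta(u,\tau)$ is finite. For $R\subseteq V\times V$: $\overrightarrow{R}_u=\{v:(u,v)\in R\}$, $\overleftarrow{R}_u=\{v:(v,u)\in R\}$, and $\widetilde{S}(p,q,R)=\bigwedge_{u\in V}\big((p(u)\rightarrow q(\overrightarrow{R}_u))\wedge(q(u)\rightarrow p(\overleftarrow{R}_u))\big)$. The lifted relation is $R_\alpha^{\dagger}=\{(p,q)\in\mathcal{R}(V)\times\mathcal{R}(V):\widetilde{S}(p,q,R)\ge\alpha\}$. $k$-limited $\alpha$-bisimilarity $\approx_k^{\alpha}\subseteq V\times V$: $u\approx_0^\alpha v$ for all $u,v$; and $u\approx_{i+1}^\alpha v$ iff for each $\tau\in\Sigma$: $u\overset{\tau}{\longrightarrow}p$ implies there is $v\overset{\tau}{\longrightarrow}q$ with $(p,q)\in(\approx_i^\alpha)_\alpha^\dagger$; and $v\overset{\tau}{\longrightarrow}q$ implies there is $u\overset{\tau}{\longrightarrow}p$ with $(p,q)\in(\approx_i^\alpha)_\alpha^\dagger$. The degree of $k$-limited similarity between $u$ and $v$ is the greatest $\alpha$ such that $u\approx_k^\alpha v$. $D_u[0]=\{u\}$ and $D_u[i+1]=\{y\in V:\exists x\in D_u[i],\tau\in\Sigma,p\in\delta(x,\tau)\text{ with }p(y)>0\}$. Algorithm. For $x,y\in V$ and $R\subseteq V\times V$, $\mathbf{Deg}((x,y),R)=\bigwedge_{x\overset{\tau}{\to}p}\bigvee_{y\overset{\tau}{\to}q}\widetilde{S}(p,q,R)\wedge\bigwedge_{y\overset{\tau}{\to}q}\bigvee_{x\overset{\tau}{\to}p}\widetilde{S}(p,q,R)$,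 computed by computing, for every pair of transitions $x\overset{\tau}{\to}p$, $y\overset{\tau}{\to}q$ with the same label, the values $p(w)\rightarrow q(\overrightarrow{R}_w)$ and $q(w)\rightarrow p(\overleftarrow{R}_w)$ for all $w\in V$ and taking their minimum, and then taking the indicated minima and maxima. For a $(k+1)$-vector $C$ of relations on $V$ and $\alpha\in[0,1]$, $\mathbf{Vec}((u,v),k,\alpha,C)$ is the $(k+1)$-vector $A$ computed by $A[k+1]=C[k+1]$ and, for $i=k,k-1,\ldots,1$, $A[i]=\{r\in C[i]:\mathbf{Deg}(r,A[i+1])\ge\alpha\}$. Degree computation: put $B(u,v)[i+1]=D_u[i]\times D_v[i]$ ($0\le i\le k$), $\alpha_0=\epsilon=0$, $T_1=\mathbf{Vec}((u,v),k,\epsilon,B(u,v))$. For $j=1,2,\ldots$: as long as $T_j[1]=\{(u,v)\}$, set $\alpha_j=\bigwedge_{1\le i\le k}\bigwedge_{r\in T_j[i]}\mathbf{Deg}(r,T_j[i+1])$; let $B_{j+1}$ be obtained from $T_j$ by deleting, from each component $T_j[i]$ with $1\le i\le k$, all $r$ with $\mathbf{Deg}(r,T_j[i+1])\le\alpha_j$ (the component $k+1$ is unchanged); and set $T_{j+1}=\mathbf{Vec}((u,v),k,\alpha_j,B_{j+1})$. When $T_j[1]=\emptyset$, stop and return $\alpha_{j-1}$.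
   Formalization: Termination with the degree is claimed for k ≥ 1 (for k = 0 the algorithm never stops); the time bound for |→| ≥ 1 (for |→| = 0 it would be 0, but comparisons are made); the degree is taken as 0 if no α qualifies; one O-constant for all systems comes from taking V, Σ inside the naturals. *)

theory Defs
  imports Complex_Main "HOL-Library.FuncSet" "HOL-Library.Extended_Nat" "HOL-Library.Monad_Syntax"
begin

section \<open>The unit interval and left-continuous t-norms\<close>

text \<open>Truth degrees are reals in \<open>{0..1}\<close>. Inserting the neutral element makes the infimum of the
  empty family \<open>1\<close> and its supremum \<open>0\<close>, as in the complete lattice $[0,1]$.\<close>

definition uInf :: "real set \<Rightarrow> real" where
  "uInf A = Inf (insert 1 A)"

definition uSup :: "real set \<Rightarrow> real" where
  "uSup A = Sup (insert 0 A)"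

locale left_continuous_tnorm =
  fixes tn :: "real \<Rightarrow> real \<Rightarrow> real"
  assumes tn_closed: "a \<in> {0..1} \<Longrightarrow> b \<in> {0..1} \<Longrightarrow> tn a b \<in> {0..1}"
    and tn_commute: "a \<in> {0..1} \<Longrightarrow> b \<in> {0..1} \<Longrightarrow> tn a b = tn b a"
    and tn_assoc: "a \<in> {0..1} \<Longrightarrow> b \<in> {0..1} \<Longrightarrow> c \<in> {0..1} \<Longrightarrow> tn (tn a b) c = tn a (tn b c)"
    and tn_mono: "a \<in> {0..1} \<Longrightarrow> b \<in> {0..1} \<Longrightarrow> c \<in> {0..1} \<Longrightarrow> a \<le> b \<Longrightarrow> tn a c \<le> tn b c"
    and tn_one: "a \<in> {0..1} \<Longrightarrow> tn 1 a = a"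
    and tn_uSup: "r \<in> {0..1} \<Longrightarrow> A \<subseteq> {0..1} \<Longrightarrow> tn r (uSup A) = uSup (tn r ` A)"
begin

definition residuum :: "real \<Rightarrow> real \<Rightarrow> real" where
  "residuum t r = uSup {s \<in> {0..1}. tn s t \<le> r}"

end

section \<open>Nondeterministic fuzzy transition systems\<close>

text \<open>A fuzzy subset of \<open>V\<close> is extensional (undefined outside \<open>V\<close>), so that equality of functions,
  and hence counting transitions, is equality of fuzzy subsets.\<close>

definition fuzzy_sets :: "'v set \<Rightarrow> ('v \<Rightarrow> real) set" where
  "fuzzy_sets V = (V \<rightarrow>\<^sub>E {0..1})"

definition fuzzy_val :: "('v \<Rightarrow> real) \<Rightarrow> 'v set \<Rightarrow> real" where
  "fuzzy_val p X = uSup (p ` X)"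

locale finite_nfts = left_continuous_tnorm tn
  for tn :: "real \<Rightarrow> real \<Rightarrow> real" +
  fixes V :: "'v set"
    and L :: "'l set"
    and \<delta> :: "('v \<times> 'l \<times> ('v \<Rightarrow> real)) set"
  assumes finite_V: "finite V"
    and nonempty_V: "V \<noteq> {}"
    and finite_L: "finite L"
    and delta_subset: "\<delta> \<subseteq> V \<times> L \<times> fuzzy_sets V"
    and finite_delta: "\<And>x \<tau>. finite {p. (x, \<tau>, p) \<in> \<delta>}"

text \<open>A transition from \<open>x\<close> is a pair of a label and a distribution: the same distribution under
  two labels is two transitions.\<close>

definition transitions_from ::
  "('v \<times> 'l \<times> ('v \<Rightarrow> real)) set \<Rightarrow> 'v \<Rightarrow> ('l \<times> ('v \<Rightarrow> real)) set" where
  "transitions_from \<delta> x = {(\<tau>, p). (x, \<tau>, p) \<in> \<delta>}"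

definition max_transitions :: "'v set \<Rightarrow> ('v \<times> 'l \<times> ('v \<Rightarrow> real)) set \<Rightarrow> nat" where
  "max_transitions V \<delta> = Max ((\<lambda>x. card (transitions_from \<delta> x)) ` V)"

section \<open>Limited bisimilarity\<close>

context finite_nfts
begin

definition S_deg :: "('v \<Rightarrow> real) \<Rightarrow> ('v \<Rightarrow> real) \<Rightarrow> ('v \<times> 'v) set \<Rightarrow> real" where
  "S_deg p q R = uInf ((\<lambda>u. min (residuum (p u) (fuzzy_val q (R `` {u})))
                               (residuum (q u) (fuzzy_val p (R\<inverse> `` {u})))) ` V)"

definition lifted :: "real \<Rightarrow> ('v \<times> 'v) set \<Rightarrow> (('v \<Rightarrow> real) \<times> ('v \<Rightarrow> real)) set" where
  "lifted \<alpha> R = {(p, q) \<in> fuzzy_sets V \<times> fuzzy_sets V. S_deg p q R \<ge> \<alpha>}"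

fun limited_bisim :: "real \<Rightarrow> nat \<Rightarrow> ('v \<times> 'v) set" where
  "limited_bisim \<alpha> 0 = V \<times> V"
| "limited_bisim \<alpha> (Suc i) = {(u, v) \<in> V \<times> V. \<forall>\<tau>\<in>L.
     (\<forall>p. (u, \<tau>, p) \<in> \<delta> \<longrightarrow> (\<exists>q. (v, \<tau>, q) \<in> \<delta> \<and> (p, q) \<in> lifted \<alpha> (limited_bisim \<alpha> i))) \<and>
     (\<forall>q. (v, \<tau>, q) \<in> \<delta> \<longrightarrow> (\<exists>p. (u, \<tau>, p) \<in> \<delta> \<and> (p, q) \<in> lifted \<alpha> (limited_bisim \<alpha> i)))}"

text \<open>If \<open>u\<close> has a transition whose label \<open>v\<close> does not offer, then not even \<open>\<alpha> = 0\<close> satisfies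
  \<open>u \<approx>\<^sub>k\<^sup>\<alpha> v\<close> for \<open>k \<ge> 1\<close>, and there is no greatest such \<open>\<alpha>\<close>. The degree is then \<open>0\<close>, the supremum
  of the empty set in $[0,1]$.\<close>

definition is_similarity_degree :: "nat \<Rightarrow> 'v \<Rightarrow> 'v \<Rightarrow> real \<Rightarrow> bool" where
  "is_similarity_degree k u v \<alpha> \<longleftrightarrow>
     (if \<exists>\<beta>\<in>{0..1}. (u, v) \<in> limited_bisim \<beta> k
      then \<alpha> \<in> {0..1} \<and> (u, v) \<in> limited_bisim \<alpha> k \<and>
           (\<forall>\<beta>\<in>{0..1}. (u, v) \<in> limited_bisim \<beta> k \<longrightarrow> \<beta> \<le> \<alpha>)
      else \<alpha> = 0)"

end

section \<open>Computations that count elementary operations\<close>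

text \<open>The second component of a timed value is the number of elementary operations
  (residuum, min, max, comparison of truth degrees) carried out to obtain the first.
  Only these operations have a cost; each of them costs one.\<close>

datatype 'a timed = Timed (val: 'a) (cost: nat)

definition tret :: "'a \<Rightarrow> 'a timed" where
  "tret a = Timed a 0"

definition tbind :: "'a timed \<Rightarrow> ('a \<Rightarrow> 'b timed) \<Rightarrow> 'b timed" where
  "tbind m f = Timed (val (f (val m))) (cost m + cost (f (val m)))"

adhoc_overloading Monad_Syntax.bind \<rightleftharpoons> tbind

definition tmin :: "real \<Rightarrow> real \<Rightarrow> real timed" where
  "tmin a b = Timed (min a b) 1"

definition tle :: "real \<Rightarrow> real \<Rightarrow> bool timed" where
  "tle a b = Timed (a \<le> b) 1"

definition tless :: "real \<Rightarrow> real \<Rightarrow> bool timed" where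
  "tless a b = Timed (a < b) 1"

text \<open>Run \<open>f i\<close> once for every element \<open>i\<close> of the finite set \<open>I\<close> and tabulate the results.\<close>

definition ttable :: "'i set \<Rightarrow> ('i \<Rightarrow> 'a timed) \<Rightarrow> ('i \<Rightarrow> 'a) timed" where
  "ttable I f = Timed (\<lambda>i. val (f i)) (\<Sum>i\<in>I. cost (f i))"

text \<open>The minimum or maximum of a finite family is accumulated starting from the neutral element,
  which takes one binary operation for each member.\<close>

definition tInf :: "'i set \<Rightarrow> ('i \<Rightarrow> real timed) \<Rightarrow> real timed" where
  "tInf I f = do { a \<leftarrow> ttable I f; Timed (uInf (a ` I)) (card I) }"

definition tSup :: "'i set \<Rightarrow> ('i \<Rightarrow> real timed) \<Rightarrow> real timed" where
  "tSup I f = do { a \<leftarrow> ttable I f; Timed (uSup (a ` I)) (card I) }"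

definition tfilter :: "'i set \<Rightarrow> ('i \<Rightarrow> bool timed) \<Rightarrow> 'i set timed" where
  "tfilter I f = do { a \<leftarrow> ttable I f; tret {i \<in> I. a i} }"

section \<open>The degree-computation algorithm\<close>

text \<open>A \<open>(k+1)\<close>-vector of relations; only the components \<open>1, \<dots>, k+1\<close> are meaningful.\<close>

type_synonym 'v relvec = "nat \<Rightarrow> ('v \<times> 'v) set"

context finite_nfts
begin

definition tres :: "real \<Rightarrow> real \<Rightarrow> real timed" where
  "tres t r = Timed (residuum t r) 1"

definition S_deg_alg :: "('v \<Rightarrow> real) \<Rightarrow> ('v \<Rightarrow> real) \<Rightarrow> ('v \<times> 'v) set \<Rightarrow> real timed" where
  "S_deg_alg p q R = tInf V (\<lambda>w. do {
     q' \<leftarrow> tSup (R `` {w}) (\<lambda>x. tret (q x));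
     l \<leftarrow> tres (p w) q';
     p' \<leftarrow> tSup (R\<inverse> `` {w}) (\<lambda>x. tret (p x));
     r \<leftarrow> tres (q w) p';
     tmin l r })"

definition Deg :: "'v \<times> 'v \<Rightarrow> ('v \<times> 'v) set \<Rightarrow> real timed" where
  "Deg = (\<lambda>(x, y) R. do {
     s \<leftarrow> ttable {(\<tau>, p, q). (x, \<tau>, p) \<in> \<delta> \<and> (y, \<tau>, q) \<in> \<delta>} (\<lambda>(\<tau>, p, q). S_deg_alg p q R);
     a \<leftarrow> tInf {(\<tau>, p). (x, \<tau>, p) \<in> \<delta>}
            (\<lambda>(\<tau>, p). tSup {q. (y, \<tau>, q) \<in> \<delta>} (\<lambda>q. tret (s (\<tau>, p, q))));
     b \<leftarrow> tInf {(\<tau>, q). (y, \<tau>, q) \<in> \<delta>}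
            (\<lambda>(\<tau>, q). tSup {p. (x, \<tau>, p) \<in> \<delta>} (\<lambda>p. tret (s (\<tau>, p, q))));
     tmin a b })"

text \<open>\<open>vec_loop \<alpha> C i A\<close> fills in the components \<open>i, i - 1, \<dots>, 1\<close>, given the higher ones in \<open>A\<close>.\<close>

fun vec_loop :: "real \<Rightarrow> 'v relvec \<Rightarrow> nat \<Rightarrow> 'v relvec \<Rightarrow> 'v relvec timed" where
  "vec_loop \<alpha> C 0 A = tret A"
| "vec_loop \<alpha> C (Suc i) A = do {
     X \<leftarrow> tfilter (C (Suc i)) (\<lambda>r. do { d \<leftarrow> Deg r (A (Suc i + 1)); tle \<alpha> d });
     vec_loop \<alpha> C i (A(Suc i := X)) }"

definition Vec :: "nat \<Rightarrow> real \<Rightarrow> 'v relvec \<Rightarrow> 'v relvec timed" where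
  "Vec k \<alpha> C = vec_loop \<alpha> C k ((\<lambda>_. {})(k + 1 := C (k + 1)))"

text \<open>\<open>layers u k\<close> computes \<open>D\<^sub>u[0], \<dots>, D\<^sub>u[k]\<close>; the comparisons are the tests \<open>p y > 0\<close>.\<close>

definition next_layer :: "'v set \<Rightarrow> 'v set timed" where
  "next_layer X = do {
     pos \<leftarrow> ttable ({(x, \<tau>, p) \<in> \<delta>. x \<in> X} \<times> V) (\<lambda>((x, \<tau>, p), y). tless 0 (p y));
     tret {y \<in> V. \<exists>x \<tau> p. x \<in> X \<and> (x, \<tau>, p) \<in> \<delta> \<and> pos ((x, \<tau>, p), y)} }"

fun layers :: "'v \<Rightarrow> nat \<Rightarrow> (nat \<Rightarrow> 'v set) timed" where
  "layers u 0 = tret ((\<lambda>_. {})(0 := {u}))"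
| "layers u (Suc i) = do {
     D \<leftarrow> layers u i;
     X \<leftarrow> next_layer (D i);
     tret (D(Suc i := X)) }"

text \<open>The state before round \<open>j \<ge> 1\<close> is \<open>(\<alpha>\<^bsub>j-1\<^esub>, T\<^sub>j)\<close>.\<close>

definition initial_state :: "nat \<Rightarrow> 'v \<Rightarrow> 'v \<Rightarrow> (real \<times> 'v relvec) timed" where
  "initial_state k u v = do {
     Du \<leftarrow> layers u k;
     Dv \<leftarrow> layers v k;
     T \<leftarrow> Vec k 0 (\<lambda>i. if i \<in> {1..k+1} then Du (i - 1) \<times> Dv (i - 1) else {});
     tret (0, T) }"

text \<open>No value of \<open>Deg\<close> is reused between the computation of \<open>\<alpha>\<^sub>j\<close>, the deletion and \<open>Vec\<close>,
  so the count is also an upper bound for implementations that store these values.\<close>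

definition loop_round :: "nat \<Rightarrow> 'v relvec \<Rightarrow> (real \<times> 'v relvec) timed" where
  "loop_round k T = do {
     \<alpha> \<leftarrow> tInf (SIGMA i:{1..k}. T i) (\<lambda>(i, r). Deg r (T (i + 1)));
     del \<leftarrow> ttable {1..k} (\<lambda>i. tfilter (T i) (\<lambda>r. do { d \<leftarrow> Deg r (T (i + 1)); tle d \<alpha> }));
     T' \<leftarrow> Vec k \<alpha> (\<lambda>i. if i \<in> {1..k} then T i - del i else T i);
     tret (\<alpha>, T') }"

text \<open>The state reached after at most \<open>n\<close> rounds, with the operations spent so far;
  once the loop has ended, the state and the cost no longer change.\<close>

fun run :: "nat \<Rightarrow> 'v \<Rightarrow> 'v \<Rightarrow> nat \<Rightarrow> (real \<times> 'v relvec) timed" where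
  "run k u v 0 = initial_state k u v"
| "run k u v (Suc n) = do {
     s \<leftarrow> run k u v n;
     if snd s 1 = {(u, v)} then loop_round k (snd s) else tret s }"

definition returns :: "nat \<Rightarrow> 'v \<Rightarrow> 'v \<Rightarrow> real \<Rightarrow> bool" where
  "returns k u v \<alpha> \<longleftrightarrow> (\<exists>n T. val (run k u v n) = (\<alpha>, T) \<and> T 1 = {})"

text \<open>The number of operations of the whole, possibly nonterminating, run.\<close>

definition running_time :: "nat \<Rightarrow> 'v \<Rightarrow> 'v \<Rightarrow> enat" where
  "running_time k u v = (SUP n. enat (cost (run k u v n)))"

end

end

theory Submission
  imports Defs
begin

text \<open>
  Correctness. The value \<open>Deg (x, y) R\<close> unfolds one step of bisimilarity: for a threshold
  \<open>a > 0\<close>, a pair of states is in \<open>\<approx>\<^sub>i\<^sub>+\<^sub>1\<^sup>a\<close> exactly if its degree relative to \<open>\<approx>\<^sub>i\<^sup>a\<close> is at least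
  \<open>a\<close> (\<open>limited_bisim_Suc_iff_Deg\<close>). Moreover \<open>Deg\<close> is monotone in the relation, and for pairs
  in layer \<open>i\<close> it depends only on the part of the relation in layer \<open>i + 1\<close>, where the successor
  distributions have their supports (\<open>Deg_mono\<close>, \<open>Deg_restrict_reach\<close>). A vector whose pairs
  have degree at least \<open>a\<close> relative to the next component is therefore contained in
  bisimilarity at threshold \<open>a\<close>, and \<open>Vec\<close> returns the greatest such vector below its argument. It
  follows that the state \<open>(a, T)\<close> of the loop satisfies an invariant (\<open>loop_invar_round\<close>): all
  pairs in \<open>T\<close> have degree at least \<open>a\<close>, and no pair that is reachable and bisimilar at some
  threshold \<open>b > a\<close> has been deleted. When \<open>(u, v)\<close> disappears, the second
  part shows that no threshold above \<open>a\<close> is possible, and the choice of \<open>a\<close> as the least degree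
  in the preceding vector, which still contained \<open>(u, v)\<close>, shows that \<open>a\<close> itself is attained.

  The threshold \<open>0\<close> is exceptional: the supremum of an empty family is \<open>0\<close>, so \<open>Deg\<close> is at least
  \<open>0\<close> even if a transition cannot be matched at all. Hence the positivity assumptions below. The
  result is not affected, since the degree of similarity is \<open>0\<close> both if \<open>0\<close> is the only admissible
  threshold and if there is none.

  Running time. Write \<open>n\<close> for the number of states and \<open>m\<close> for the maximal number of transitions
  from a state. A relation has at most \<open>n\<^sup>2\<close> pairs, so comparing two
  distributions costs \<open>O(n\<^sup>2)\<close>, and \<open>Deg\<close> does so for at most \<open>m\<^sup>2\<close> pairs of transitions. A round
  evaluates \<open>Deg\<close> at most three times for each of the \<open>k n\<^sup>2\<close> positions of the vector, and
  thus costs \<open>O(k n\<^sup>4 m\<^sup>2)\<close>. Every round deletes a pair that attains the least degree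
  (\<open>potential_round\<close>), so there are at most \<open>k n\<^sup>2\<close> rounds.
\<close>

section \<open>Infima and suprema of truth degrees\<close>

lemma uInf_le_one:
  assumes "A \<subseteq> {0..}"
  shows "uInf A \<le> 1"
  unfolding uInf_def using assms by (intro cInf_lower bdd_belowI[of _ 0]) auto

lemma le_uInf_iff:
  assumes "A \<subseteq> {0..}"
  shows "a \<le> uInf A \<longleftrightarrow> a \<le> 1 \<and> (\<forall>x\<in>A. a \<le> x)"
  unfolding uInf_def using assms by (subst le_cInf_iff) (auto intro!: bdd_belowI[of _ 0])

lemma uInf_attained:
  assumes "finite A"
  shows "uInf A \<in> insert 1 A"
  unfolding uInf_def using assms Min_in[of "insert 1 A"] by (subst cInf_eq_Min) (auto simp del: Min_in)

lemma uInf_mem: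
  assumes "A \<subseteq> {0..}"
  shows "uInf A \<in> {0..1}"
  using assms le_uInf_iff[OF assms, of 0] uInf_le_one[OF assms] by auto

lemma uSup_le_iff:
  assumes "A \<subseteq> {..1}"
  shows "uSup A \<le> a \<longleftrightarrow> 0 \<le> a \<and> (\<forall>x\<in>A. x \<le> a)"
  unfolding uSup_def using assms by (subst cSup_le_iff) (auto intro!: bdd_aboveI[of _ 1])

lemma uSup_mem:
  assumes "A \<subseteq> {..1}"
  shows "uSup A \<in> {0..1}"
  using assms uSup_le_iff[OF assms, of 1] uSup_le_iff[OF assms, of "uSup A"] by auto

text \<open>For a positive threshold the neutral element \<open>0\<close> cannot be the witness.\<close>

lemma le_uSup_iff:
  assumes "finite A" "0 < a"
  shows "a \<le> uSup A \<longleftrightarrow> (\<exists>x\<in>A. a \<le> x)"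
  unfolding uSup_def using assms by (subst cSup_eq_Max) (auto simp del: Max_insert simp: Max_ge_iff)

lemma uSup_mono:
  assumes "A \<subseteq> B" "B \<subseteq> {..1}"
  shows "uSup A \<le> uSup B"
  unfolding uSup_def using assms by (intro cSup_subset_mono) (auto intro!: bdd_aboveI[of _ 1])

text \<open>A zero member may be dropped, because the neutral element of the supremum is \<open>0\<close>.\<close>

lemma uSup_cong_positive:
  assumes "A \<subseteq> B" "\<And>x. x \<in> B - A \<Longrightarrow> x = 0"
  shows "uSup A = uSup B"
proof -
  have "insert 0 A = insert 0 B"
    using assms by auto
  then show ?thesis
    by (simp add: uSup_def)
qed

context left_continuous_tnorm
begin

lemma residuum_mem: "residuum t r \<in> {0..1}"
  unfolding residuum_def by (rule uSup_mem) auto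

lemma residuum_mono: "r \<le> r' \<Longrightarrow> residuum t r \<le> residuum t r'"
  unfolding residuum_def by (rule uSup_mono) auto

lemma residuum_zero:
  assumes "0 \<le> r"
  shows "residuum 0 r = 1"
proof -
  have "tn 1 0 \<le> r"
    using assms by (simp add: tn_one)
  moreover have "s \<le> uSup {s \<in> {0..1}. tn s 0 \<le> r}" if "s \<in> {s \<in> {0..1}. tn s 0 \<le> r}" for s
    using uSup_le_iff[of "{s \<in> {0..1}. tn s 0 \<le> r}" "uSup {s \<in> {0..1}. tn s 0 \<le> r}"] that
    by fastforce
  ultimately have "1 \<le> uSup {s \<in> {0..1}. tn s 0 \<le> r}"
    by simp
  then show ?thesis
    using residuum_mem[of 0 r] by (auto simp: residuum_def)
qed

end

section \<open>Values and costs of the timed combinators\<close>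

lemma timed_simps [simp]:
  "val (tret a) = a" "cost (tret a) = 0"
  "val (tbind m f) = val (f (val m))" "cost (tbind m f) = cost m + cost (f (val m))"
  "val (tmin x y) = min x y" "cost (tmin x y) = 1"
  "val (tle x y) = (x \<le> y)" "cost (tle x y) = 1"
  "val (tless x y) = (x < y)" "cost (tless x y) = 1"
  by (simp_all add: tret_def tbind_def tmin_def tle_def tless_def)

lemma timed_family_simps [simp]:
  "val (ttable I g) = (\<lambda>i. val (g i))" "cost (ttable I g) = (\<Sum>i\<in>I. cost (g i))"
  "val (tInf I h) = uInf ((\<lambda>i. val (h i)) ` I)" "cost (tInf I h) = (\<Sum>i\<in>I. cost (h i)) + card I"
  "val (tSup I h) = uSup ((\<lambda>i. val (h i)) ` I)" "cost (tSup I h) = (\<Sum>i\<in>I. cost (h i)) + card I"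
  "val (tfilter I b) = {i \<in> I. val (b i)}" "cost (tfilter I b) = (\<Sum>i\<in>I. cost (b i))"
  by (simp_all add: ttable_def tInf_def tSup_def tfilter_def)

lemma sum_cost_le:
  fixes g :: "'i \<Rightarrow> nat"
  assumes "\<And>i. i \<in> I \<Longrightarrow> g i \<le> b" "card I \<le> n"
  shows "sum g I \<le> n * b"
  using order_trans[OF sum_bounded_above[of I g b, OF assms(1)]] mult_le_mono1[OF assms(2), of b] by simp

context finite_nfts
begin

lemma tres_simps [simp]: "val (tres t r) = residuum t r" "cost (tres t r) = 1"
  by (simp_all add: tres_def)

section \<open>The similarity of distributions as a function of the relation\<close>

lemma transition_V: "(x, \<tau>, p) \<in> \<delta> \<Longrightarrow> x \<in> V"
  and transition_L: "(x, \<tau>, p) \<in> \<delta> \<Longrightarrow> \<tau> \<in> L"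
  and transition_fuzzy: "(x, \<tau>, p) \<in> \<delta> \<Longrightarrow> p \<in> fuzzy_sets V"
  using delta_subset by auto

lemma fuzzy_sets_mem: "p \<in> fuzzy_sets V \<Longrightarrow> x \<in> V \<Longrightarrow> 0 \<le> p x \<and> p x \<le> 1"
  by (force simp: fuzzy_sets_def PiE_iff)

lemma fuzzy_val_mem: "p \<in> fuzzy_sets V \<Longrightarrow> X \<subseteq> V \<Longrightarrow> fuzzy_val p X \<in> {0..1}"
  unfolding fuzzy_val_def by (rule uSup_mem) (use fuzzy_sets_mem in auto)

lemma fuzzy_val_mono: "p \<in> fuzzy_sets V \<Longrightarrow> X \<subseteq> Y \<Longrightarrow> Y \<subseteq> V \<Longrightarrow> fuzzy_val p X \<le> fuzzy_val p Y"
  unfolding fuzzy_val_def by (rule uSup_mono) (use fuzzy_sets_mem in auto)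

lemma fuzzy_val_cong_support:
  assumes "\<And>x. x \<in> Y \<Longrightarrow> x \<notin> X \<Longrightarrow> p x = 0" "X \<subseteq> Y"
  shows "fuzzy_val p X = fuzzy_val p Y"
  unfolding fuzzy_val_def using assms by (intro uSup_cong_positive) auto

lemma le_S_deg_iff:
  "a \<le> S_deg p q R \<longleftrightarrow> a \<le> 1 \<and>
    (\<forall>w\<in>V. a \<le> residuum (p w) (fuzzy_val q (R `` {w})) \<and>
            a \<le> residuum (q w) (fuzzy_val p (R\<inverse> `` {w})))"
  unfolding S_deg_def using residuum_mem by (subst le_uInf_iff) (auto simp: image_subset_iff)

lemma S_deg_mem: "S_deg p q R \<in> {0..1}"
  unfolding S_deg_def using residuum_mem by (intro uInf_mem) (auto simp: image_subset_iff)

lemma S_deg_mono: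
  assumes "p \<in> fuzzy_sets V" "q \<in> fuzzy_sets V" "R \<subseteq> R'" "R' \<subseteq> V \<times> V"
  shows "S_deg p q R \<le> S_deg p q R'"
proof -
  have "residuum (p w) (fuzzy_val q (R `` {w})) \<le> residuum (p w) (fuzzy_val q (R' `` {w}))"
    "residuum (q w) (fuzzy_val p (R\<inverse> `` {w})) \<le> residuum (q w) (fuzzy_val p (R'\<inverse> `` {w}))" for w
    using assms by (auto intro!: residuum_mono fuzzy_val_mono)
  moreover have "S_deg p q R \<le> S_deg p q R" ..
  ultimately show ?thesis
    unfolding le_S_deg_iff[of _ p q R'] by (subst (asm) le_S_deg_iff) (meson order_trans)
qed

text \<open>Outside the support of \<open>p\<close> the residuum \<open>p w \<rightarrow> _\<close> is \<open>1\<close>, and outside the support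
  of \<open>q\<close> nothing is added to a supremum of values of \<open>q\<close>. So only pairs of supporting states
  matter, which is why the algorithm may confine itself to reachable pairs.\<close>

lemma S_deg_restrict:
  assumes p: "p \<in> fuzzy_sets V" and q: "q \<in> fuzzy_sets V" and R: "R \<subseteq> V \<times> V"
    and X: "\<And>w. w \<in> V \<Longrightarrow> w \<notin> X \<Longrightarrow> p w = 0" and Y: "\<And>w. w \<in> V \<Longrightarrow> w \<notin> Y \<Longrightarrow> q w = 0"
  shows "S_deg p q (R \<inter> X \<times> Y) = S_deg p q R"
proof -
  have "residuum (p w) (fuzzy_val q ((R \<inter> X \<times> Y) `` {w})) = residuum (p w) (fuzzy_val q (R `` {w}))"
    if "w \<in> V" for w
  proof (cases "w \<in> X")
    case True
    then have "fuzzy_val q ((R \<inter> X \<times> Y) `` {w}) = fuzzy_val q (R `` {w})"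
      using R Y by (intro fuzzy_val_cong_support) auto
    then show ?thesis
      by simp
  next
    case False
    then have "p w = 0"
      using X that by auto
    moreover have "0 \<le> fuzzy_val q (S `` {w})" if "S \<subseteq> R" for S
      using fuzzy_val_mem[OF q, of "S `` {w}"] that R by auto
    ultimately show ?thesis
      by (simp add: residuum_zero)
  qed
  moreover
  have "residuum (q w) (fuzzy_val p ((R \<inter> X \<times> Y)\<inverse> `` {w})) = residuum (q w) (fuzzy_val p (R\<inverse> `` {w}))"
    if "w \<in> V" for w
  proof (cases "w \<in> Y")
    case True
    then have "fuzzy_val p ((R \<inter> X \<times> Y)\<inverse> `` {w}) = fuzzy_val p (R\<inverse> `` {w})"
      using R X by (intro fuzzy_val_cong_support) auto
    then show ?thesis
      by simp
  next
    case False
    then have "q w = 0"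
      using Y that by auto
    moreover have "0 \<le> fuzzy_val p (S\<inverse> `` {w})" if "S \<subseteq> R" for S
      using fuzzy_val_mem[OF p, of "S\<inverse> `` {w}"] that R by auto
    ultimately show ?thesis
      by (simp add: residuum_zero)
  qed
  ultimately show ?thesis
    unfolding S_deg_def by simp
qed

section \<open>Degrees and limited bisimilarity\<close>

lemma val_S_deg_alg [simp]: "val (S_deg_alg p q R) = S_deg p q R"
  by (simp add: S_deg_alg_def S_deg_def fuzzy_val_def)

lemma finite_transitions: "finite (transitions_from \<delta> x)"
proof (rule finite_subset)
  show "transitions_from \<delta> x \<subseteq> (SIGMA \<tau>:L. {p. (x, \<tau>, p) \<in> \<delta>})"
    using transition_L by (auto simp: transitions_from_def)
qed (use finite_L finite_delta in auto)

lemma val_Deg: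
  "val (Deg (x, y) R) = min
     (uInf ((\<lambda>(\<tau>, p). uSup ((\<lambda>q. S_deg p q R) ` {q. (y, \<tau>, q) \<in> \<delta>})) ` transitions_from \<delta> x))
     (uInf ((\<lambda>(\<tau>, q). uSup ((\<lambda>p. S_deg p q R) ` {p. (x, \<tau>, p) \<in> \<delta>})) ` transitions_from \<delta> y))"
  by (simp add: Deg_def transitions_from_def case_prod_unfold)

lemma uSup_S_deg_nonneg: "0 \<le> uSup ((\<lambda>i. S_deg (f i) (g i) R) ` I)"
  using uSup_mem[of "(\<lambda>i. S_deg (f i) (g i) R) ` I"] S_deg_mem by (auto simp: image_subset_iff)

lemma Deg_mem: "val (Deg r R) \<in> {0..1}"
proof (cases r)
  case (Pair x y)
  show ?thesis
    unfolding Pair val_Deg min_def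
    by (auto simp del: atLeastAtMost_iff simp: image_subset_iff case_prod_unfold
        intro!: uInf_mem uSup_S_deg_nonneg)
qed

lemma le_Deg_iff:
  assumes "0 < a" "a \<le> 1"
  shows "a \<le> val (Deg (x, y) R) \<longleftrightarrow>
    (\<forall>\<tau> p. (x, \<tau>, p) \<in> \<delta> \<longrightarrow> (\<exists>q. (y, \<tau>, q) \<in> \<delta> \<and> a \<le> S_deg p q R)) \<and>
    (\<forall>\<tau> q. (y, \<tau>, q) \<in> \<delta> \<longrightarrow> (\<exists>p. (x, \<tau>, p) \<in> \<delta> \<and> a \<le> S_deg p q R))"
  unfolding val_Deg min.bounded_iff
  using assms
  by (subst (1 2) le_uInf_iff)
    (auto simp: image_subset_iff case_prod_unfold uSup_S_deg_nonneg le_uSup_iff finite_delta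
      transitions_from_def)

lemma Deg_mono:
  assumes "R \<subseteq> R'" "R' \<subseteq> V \<times> V"
  shows "val (Deg r R) \<le> val (Deg r R')"
proof (cases "val (Deg r R) = 0")
  \<comment> \<open>\<open>le_Deg_iff\<close> characterises positive thresholds only.\<close>
  case True
  then show ?thesis
    using Deg_mem[of r R'] by auto
next
  case False
  obtain x y where r: "r = (x, y)"
    by force
  have a: "0 < val (Deg r R)" "val (Deg r R) \<le> 1"
    using Deg_mem[of r R] False by auto
  have mono: "S_deg p q R \<le> S_deg p q R'" if "(x, \<tau>, p) \<in> \<delta>" "(y, \<tau>, q) \<in> \<delta>" for \<tau> p q
    by (rule S_deg_mono[OF transition_fuzzy[OF that(1)] transition_fuzzy[OF that(2)] assms])
  have "val (Deg r R) \<le> val (Deg (x, y) R)"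
    by (simp add: r)
  then show ?thesis
    unfolding r le_Deg_iff[OF a[unfolded r]] using mono by (meson order_trans)
qed

lemma limited_bisim_subset: "limited_bisim a i \<subseteq> V \<times> V"
  by (cases i) auto

lemma limited_bisim_Suc_iff_Deg:
  assumes "0 < a" "a \<le> 1" "r \<in> V \<times> V"
  shows "r \<in> limited_bisim a (Suc i) \<longleftrightarrow> a \<le> val (Deg r (limited_bisim a i))"
proof -
  obtain x y where r: "r = (x, y)"
    by force
  show ?thesis
    unfolding r le_Deg_iff[OF assms(1,2)] using assms(3) transition_L transition_fuzzy
    by (auto simp: r lifted_def) blast+
qed

fun reach :: "'v \<Rightarrow> nat \<Rightarrow> 'v set" where
  "reach u 0 = {u}"
| "reach u (Suc i) = {y \<in> V. \<exists>x \<tau> p. x \<in> reach u i \<and> (x, \<tau>, p) \<in> \<delta> \<and> 0 < p y}"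

lemma reach_subset: "u \<in> V \<Longrightarrow> reach u i \<subseteq> V"
  by (cases i) auto

lemma reach_support:
  assumes "x \<in> reach u i" "(x, \<tau>, p) \<in> \<delta>" "w \<in> V" "w \<notin> reach u (Suc i)"
  shows "p w = 0"
  using assms fuzzy_sets_mem[OF transition_fuzzy[OF assms(2)], of w]
  by (metis (mono_tags, lifting) mem_Collect_eq order_le_less reach.simps(2))

lemma Deg_restrict_reach:
  assumes "r \<in> reach u i \<times> reach v i" "0 < a" "a \<le> 1" "R \<subseteq> V \<times> V" "a \<le> val (Deg r R)"
  shows "a \<le> val (Deg r (R \<inter> reach u (Suc i) \<times> reach v (Suc i)))"
proof -
  obtain x y where r: "r = (x, y)"
    by force
  have "S_deg p q (R \<inter> reach u (Suc i) \<times> reach v (Suc i)) = S_deg p q R"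
    if "(x, \<tau>, p) \<in> \<delta>" "(y, \<tau>, q) \<in> \<delta>" for \<tau> p q
    using assms(1) r that
    by (intro S_deg_restrict assms(4)) (auto intro: transition_fuzzy reach_support simp del: reach.simps)
  then show ?thesis
    using assms(5) unfolding r le_Deg_iff[OF assms(2,3)] by metis
qed

section \<open>The loop invariant\<close>

lemma val_layers: "i \<le> k \<Longrightarrow> val (layers u k) i = reach u i"
proof (induction k arbitrary: i)
  case (Suc k)
  show ?case
    using Suc by (cases "i = Suc k") (auto simp: next_layer_def)
qed simp

lemma vec_loop_above: "i < j \<Longrightarrow> val (vec_loop a C i A) j = A j"
  by (induction i arbitrary: A) auto

lemma vec_loop_below:
  "1 \<le> j \<Longrightarrow> j \<le> i \<Longrightarrow>
    val (vec_loop a C i A) j = {r \<in> C j. a \<le> val (Deg r (val (vec_loop a C i A) (j + 1)))}"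
proof (induction i arbitrary: A)
  case (Suc i)
  then show ?case
    by (cases "j = Suc i") (auto simp: vec_loop_above)
qed simp

lemma Vec_top: "val (Vec k a C) (k + 1) = C (k + 1)"
  by (simp add: Vec_def vec_loop_above)

lemma Vec_below:
  "1 \<le> j \<Longrightarrow> j \<le> k \<Longrightarrow> val (Vec k a C) j = {r \<in> C j. a \<le> val (Deg r (val (Vec k a C) (j + 1)))}"
  unfolding Vec_def by (rule vec_loop_below)

lemma Vec_subset: "1 \<le> j \<Longrightarrow> j \<le> k + 1 \<Longrightarrow> val (Vec k a C) j \<subseteq> C j"
  using Vec_below[of j k a C] Vec_top[of k a C] by (cases "j = k + 1") auto

text \<open>\<open>Vec\<close> computes the greatest vector below \<open>C\<close> all of whose pairs have degree at least \<open>a\<close>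
  relative to the next component.\<close>

lemma Vec_greatest:
  assumes "\<And>i. 1 \<le> i \<Longrightarrow> i \<le> k + 1 \<Longrightarrow> W i \<subseteq> C i"
    and "\<And>i. 1 \<le> i \<Longrightarrow> i \<le> k + 1 \<Longrightarrow> C i \<subseteq> V \<times> V"
    and "\<And>i r. 1 \<le> i \<Longrightarrow> i \<le> k \<Longrightarrow> r \<in> W i \<Longrightarrow> a \<le> val (Deg r (W (i + 1)))"
    and "1 \<le> j" "j \<le> k + 1"
  shows "W j \<subseteq> val (Vec k a C) j"
  using assms(5,4)
proof (induction j rule: inc_induct)
  case base
  then show ?case
    using assms(1)[of "k + 1"] Vec_top[of k a C] by simp
next
  case (step j)
  have "val (Vec k a C) (j + 1) \<subseteq> V \<times> V"
    using Vec_subset[of "j + 1" k a C] assms(2)[of "j + 1"] step.hyps by simp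
  then have "val (Deg r (W (j + 1))) \<le> val (Deg r (val (Vec k a C) (j + 1)))" for r
    using step by (intro Deg_mono) auto
  then have "a \<le> val (Deg r (val (Vec k a C) (j + 1)))" if "r \<in> W j" for r
    using order_trans[OF assms(3)[of j r]] step.hyps step.prems that by simp
  moreover have "W j \<subseteq> C j"
    using assms(1) step.hyps step.prems by simp
  ultimately show ?case
    using Vec_below[of j k a C] step.hyps step.prems by auto
qed

text \<open>The pairs that the algorithm must keep as long as its threshold is below \<open>b\<close>. Component \<open>i\<close>
  of a vector lies \<open>i - 1\<close> steps after the start, with \<open>k + 1 - i\<close> steps left to match.\<close>

definition reach_bisim :: "nat \<Rightarrow> 'v \<Rightarrow> 'v \<Rightarrow> real \<Rightarrow> 'v relvec" where
  "reach_bisim k u v b i =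
     limited_bisim b (k + 1 - i) \<inter> reach u (i - 1) \<times> reach v (i - 1)"

lemma Deg_reach_bisim:
  assumes "0 < b" "b \<le> 1" "1 \<le> i" "i \<le> k" "r \<in> reach_bisim k u v b i"
  shows "b \<le> val (Deg r (reach_bisim k u v b (i + 1)))"
proof -
  have i: "k + 1 - i = Suc (k - i)" "Suc (i - 1) = i"
    using assms by auto
  have r: "r \<in> limited_bisim b (Suc (k - i))" "r \<in> reach u (i - 1) \<times> reach v (i - 1)"
    using assms(5) i by (auto simp: reach_bisim_def simp del: limited_bisim.simps)
  then have "b \<le> val (Deg r (limited_bisim b (k - i)))"
    using limited_bisim_Suc_iff_Deg[OF assms(1,2)] limited_bisim_subset by blast
  from Deg_restrict_reach[OF r(2) assms(1,2) limited_bisim_subset this] show ?thesis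
    unfolding i(2) by (simp add: reach_bisim_def del: reach.simps)
qed

text \<open>A vector whose pairs all have degree at least \<open>a\<close> relative to the next component is a
  layered version of a post-fixed point, hence contained in bisimilarity at threshold \<open>a\<close>.\<close>

lemma stable_subset_limited_bisim:
  assumes "0 < a" "a \<le> 1"
    and "\<And>i. 1 \<le> i \<Longrightarrow> i \<le> k + 1 \<Longrightarrow> T i \<subseteq> V \<times> V"
    and "\<And>i r. 1 \<le> i \<Longrightarrow> i \<le> k \<Longrightarrow> r \<in> T i \<Longrightarrow> a \<le> val (Deg r (T (i + 1)))"
    and "1 \<le> j" "j \<le> k + 1"
  shows "T j \<subseteq> limited_bisim a (k + 1 - j)"
  using assms(6,5)
proof (induction j rule: inc_induct)
  case base
  then show ?case
    using assms(3)[of "k + 1"] by simp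
next
  case (step j)
  have j: "k + 1 - j = Suc (k - j)"
    using step.hyps by simp
  have "T (j + 1) \<subseteq> limited_bisim a (k - j)"
    using step by simp
  note mono = Deg_mono[OF this limited_bisim_subset]
  have "a \<le> val (Deg r (limited_bisim a (k - j)))" if "r \<in> T j" for r
    using order_trans[OF assms(4)[of j r] mono] step.hyps step.prems that by simp
  moreover have "T j \<subseteq> V \<times> V"
    using assms(3) step.hyps step.prems by simp
  ultimately show ?case
    unfolding j using limited_bisim_Suc_iff_Deg[OF assms(1,2)] by blast
qed

text \<open>The last conjunct is needed because correctness at the end depends on the vector before the
  last round, which is no longer part of the state.\<close>

definition loop_invar :: "nat \<Rightarrow> 'v \<Rightarrow> 'v \<Rightarrow> real \<times> 'v relvec \<Rightarrow> bool" where
  "loop_invar k u v = (\<lambda>(a, T). 0 \<le> a \<and> a \<le> 1 \<and>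
     (\<forall>i. 1 \<le> i \<longrightarrow> i \<le> k + 1 \<longrightarrow> T i \<subseteq> reach u (i - 1) \<times> reach v (i - 1)) \<and>
     (\<forall>i r. 1 \<le> i \<longrightarrow> i \<le> k \<longrightarrow> r \<in> T i \<longrightarrow> a \<le> val (Deg r (T (i + 1)))) \<and>
     (\<forall>b i. a < b \<longrightarrow> b \<le> 1 \<longrightarrow> 1 \<le> i \<longrightarrow> i \<le> k + 1 \<longrightarrow> reach_bisim k u v b i \<subseteq> T i) \<and>
     (T 1 = {} \<longrightarrow> is_similarity_degree k u v a))"

lemma loop_invarD:
  assumes "loop_invar k u v (a, T)"
  shows "0 \<le> a" "a \<le> 1"
    and "\<And>i. 1 \<le> i \<Longrightarrow> i \<le> k + 1 \<Longrightarrow> T i \<subseteq> reach u (i - 1) \<times> reach v (i - 1)"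
    and "\<And>i r. 1 \<le> i \<Longrightarrow> i \<le> k \<Longrightarrow> r \<in> T i \<Longrightarrow> a \<le> val (Deg r (T (i + 1)))"
    and "\<And>b i. a < b \<Longrightarrow> b \<le> 1 \<Longrightarrow> 1 \<le> i \<Longrightarrow> i \<le> k + 1 \<Longrightarrow> reach_bisim k u v b i \<subseteq> T i"
    and "T 1 = {} \<Longrightarrow> is_similarity_degree k u v a"
  using assms unfolding loop_invar_def by blast+

lemma loop_invar_subset:
  assumes "loop_invar k u v (a, T)" "u \<in> V" "v \<in> V" "1 \<le> i" "i \<le> k + 1"
  shows "T i \<subseteq> V \<times> V"
  using loop_invarD(3)[OF assms(1,4,5)] reach_subset[OF assms(2), of "i - 1"]
    reach_subset[OF assms(3), of "i - 1"] by blast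

lemma loop_invar_start:
  assumes "loop_invar k u v (a, T)"
  shows "T 1 = {} \<or> T 1 = {(u, v)}"
  using loop_invarD(3)[OF assms, of 1] by auto

lemma val_initial_state:
  "\<exists>C. val (initial_state k u v) = (0, val (Vec k 0 C)) \<and>
    (\<forall>i. 1 \<le> i \<longrightarrow> i \<le> k + 1 \<longrightarrow> C i = reach u (i - 1) \<times> reach v (i - 1))"
proof -
  define C where "C = (\<lambda>i. if i \<in> {1..k+1} then val (layers u k) (i - 1) \<times> val (layers v k) (i - 1) else {})"
  have "val (initial_state k u v) = (0, val (Vec k 0 C))"
    by (simp add: initial_state_def C_def)
  moreover have "C i = reach u (i - 1) \<times> reach v (i - 1)" if "1 \<le> i" "i \<le> k + 1" for i
    using that val_layers[of "i - 1" k] by (auto simp: C_def)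
  ultimately show ?thesis
    by blast
qed

lemma loop_invar_initial:
  assumes "u \<in> V" "v \<in> V"
  shows "loop_invar k u v (val (initial_state k u v))"
proof -
  obtain C where C: "val (initial_state k u v) = (0, val (Vec k 0 C))"
    "\<And>i. 1 \<le> i \<Longrightarrow> i \<le> k + 1 \<Longrightarrow> C i = reach u (i - 1) \<times> reach v (i - 1)"
    using val_initial_state by metis
  have nonneg: "0 \<le> val (Deg r R)" for r R
    using Deg_mem[of r R] by auto
  have "val (Vec k 0 C) i = C i" if "1 \<le> i" "i \<le> k + 1" for i
    using that Vec_below[of i k 0 C] Vec_top[of k 0 C] nonneg by (cases "i = k + 1") auto
  then show ?thesis
    using C nonneg by (auto simp: loop_invar_def reach_bisim_def)
qed

definition round_vec :: "nat \<Rightarrow> real \<Rightarrow> 'v relvec \<Rightarrow> 'v relvec" where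
  "round_vec k a T =
     (\<lambda>i. if i \<in> {1..k} then T i - {r \<in> T i. val (Deg r (T (i + 1))) \<le> a} else T i)"

definition round_degree :: "nat \<Rightarrow> 'v relvec \<Rightarrow> real" where
  "round_degree k T = uInf ((\<lambda>(i, r). val (Deg r (T (i + 1)))) ` (SIGMA i:{1..k}. T i))"

lemma val_loop_round:
  "val (loop_round k T) =
     (round_degree k T, val (Vec k (round_degree k T) (round_vec k (round_degree k T) T)))"
  by (simp add: loop_round_def round_degree_def round_vec_def case_prod_unfold cong: if_cong)

lemma le_round_degree_iff:
  "a \<le> round_degree k T \<longleftrightarrow>
     a \<le> 1 \<and> (\<forall>i r. 1 \<le> i \<longrightarrow> i \<le> k \<longrightarrow> r \<in> T i \<longrightarrow> a \<le> val (Deg r (T (i + 1))))"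
  unfolding round_degree_def using Deg_mem by (subst le_uInf_iff) (auto simp: image_subset_iff)

lemma loop_invar_round:
  assumes V: "u \<in> V" "v \<in> V" and inv: "loop_invar k u v (a, T)" and T1: "T 1 = {(u, v)}"
    and k: "1 \<le> k"
  shows "loop_invar k u v (val (loop_round k T))"
proof -
  let ?a = "round_degree k T" and ?B = "round_vec k (round_degree k T) T"
  let ?T = "val (Vec k ?a ?B)"
  note I = loop_invarD[OF inv]
  have a: "a \<le> ?a" "?a \<le> 1"
    and Deg: "\<And>i r. 1 \<le> i \<Longrightarrow> i \<le> k \<Longrightarrow> r \<in> T i \<Longrightarrow> ?a \<le> val (Deg r (T (i + 1)))"
    using I le_round_degree_iff[of a k T] le_round_degree_iff[of ?a k T] by blast+
  have sub: "?B i \<subseteq> T i" for i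
    by (auto simp: round_vec_def)
  have W: "reach_bisim k u v b i \<subseteq> ?T i" if b: "?a < b" "b \<le> 1" and i: "1 \<le> i" "i \<le> k + 1" for b i
  proof (rule Vec_greatest)
    have b0: "0 < b" "a < b"
      using b a I by auto
    show "reach_bisim k u v b j \<subseteq> ?B j" if j: "1 \<le> j" "j \<le> k + 1" for j
    proof
      fix r assume r: "r \<in> reach_bisim k u v b j"
      then have "r \<in> T j"
        using I(5)[OF b0(2) b(2) j] by auto
      moreover have "?a < val (Deg r (T (j + 1)))" if "j \<le> k"
      proof -
        have "reach_bisim k u v b (j + 1) \<subseteq> T (j + 1)" "T (j + 1) \<subseteq> V \<times> V"
          using I(5)[OF b0(2) b(2)] loop_invar_subset[OF inv V] that by auto
        from Deg_mono[OF this, of r] show ?thesis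
          using Deg_reach_bisim[OF b0(1) b(2) j(1) that r] b(1) by linarith
      qed
      ultimately show "r \<in> ?B j"
        by (auto simp: round_vec_def)
    qed
    show "?B j \<subseteq> V \<times> V" if "1 \<le> j" "j \<le> k + 1" for j
      using sub loop_invar_subset[OF inv V that] by blast
    show "?a \<le> val (Deg r (reach_bisim k u v b (j + 1)))"
      if "1 \<le> j" "j \<le> k" "r \<in> reach_bisim k u v b j" for j r
      using Deg_reach_bisim[OF b0(1) b(2) that] b(1) by simp
  qed (use i in auto)
  have degree: "is_similarity_degree k u v ?a" if "?T 1 = {}"
  proof -
    have ub: "b \<le> ?a" if b: "b \<in> {0..1}" "(u, v) \<in> limited_bisim b k" for b
    proof (rule ccontr)
      assume "\<not> b \<le> ?a"
      moreover have "(u, v) \<in> reach_bisim k u v b 1"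
        using b by (simp add: reach_bisim_def)
      ultimately show False
        using W[of b 1] b \<open>?T 1 = {}\<close> by auto
    qed
    show ?thesis
    proof (cases "?a = 0")
      case True
      \<comment> \<open>By \<open>ub\<close>, the admissible thresholds are a subset of \<open>{0}\<close>; either way the degree is \<open>0\<close>.\<close>
      then show ?thesis
        using ub by (force simp: is_similarity_degree_def)
    next
      case False
      then have pos: "0 < ?a"
        using I(1) a(1) by simp
      have "T 1 \<subseteq> limited_bisim ?a (k + 1 - 1)"
        using pos a Deg loop_invar_subset[OF inv V]
        by (intro stable_subset_limited_bisim[of ?a k T 1]) auto
      then have "(u, v) \<in> limited_bisim ?a k"
        using T1 by simp
      then show ?thesis
        using ub a pos unfolding is_similarity_degree_def by (auto intro!: bexI[of _ ?a])
    qed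
  qed
  have "?T i \<subseteq> reach u (i - 1) \<times> reach v (i - 1)" if "1 \<le> i" "i \<le> k + 1" for i
    using Vec_subset[OF that, of ?a ?B] sub I(3)[OF that] by blast
  moreover have "?a \<le> val (Deg r (?T (i + 1)))" if "1 \<le> i" "i \<le> k" "r \<in> ?T i" for i r
    using Vec_below[OF that(1,2), of ?a ?B] that(3) by blast
  moreover have "0 \<le> ?a"
    using a I by auto
  ultimately show ?thesis
    unfolding val_loop_round loop_invar_def prod.case using a(2) W degree by simp
qed

section \<open>The number of rounds\<close>

definition potential :: "nat \<Rightarrow> 'v relvec \<Rightarrow> nat" where
  "potential k T = card (SIGMA i:{1..k}. T i)"

lemma finite_pairs:
  assumes "\<And>i. 1 \<le> i \<Longrightarrow> i \<le> k \<Longrightarrow> T i \<subseteq> V \<times> V"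
  shows "finite (SIGMA i:{1..k::nat}. T i)"
  using assms finite_subset[OF _ finite_cartesian_product[OF finite_V finite_V]]
  by (intro finite_SigmaI) auto

lemma card_pairs_le: "R \<subseteq> V \<times> V \<Longrightarrow> card R \<le> card V ^ 2"
  using card_mono[of "V \<times> V" R] finite_V by (simp add: card_cartesian_product power2_eq_square)

lemma potential_le:
  assumes "\<And>i. 1 \<le> i \<Longrightarrow> i \<le> k \<Longrightarrow> T i \<subseteq> V \<times> V"
  shows "potential k T \<le> k * card V ^ 2"
proof -
  have "finite (T i)" if "1 \<le> i" "i \<le> k" for i
    using assms[OF that] finite_V finite_subset by blast
  then have "potential k T = (\<Sum>i\<in>{1..k}. card (T i))"
    unfolding potential_def by (subst card_SigmaI) auto
  also have "\<dots> \<le> k * card V ^ 2"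
    using assms card_pairs_le by (intro sum_cost_le) auto
  finally show ?thesis .
qed

text \<open>The threshold of a round is the least degree of a surviving pair; it is attained because
  there are finitely many pairs, so the pair attaining it is deleted.\<close>

lemma potential_round:
  assumes T: "\<And>i. 1 \<le> i \<Longrightarrow> i \<le> k + 1 \<Longrightarrow> T i \<subseteq> V \<times> V" and ne: "1 \<le> k" "T 1 \<noteq> {}"
  shows "potential k (snd (val (loop_round k T))) < potential k T"
proof -
  let ?P = "SIGMA i:{1..k}. T i" and ?f = "\<lambda>(i, r). val (Deg r (T (i + 1)))"
  let ?a = "round_degree k T"
  let ?T = "val (Vec k ?a (round_vec k ?a T))"
  have fin: "finite ?P"
    using T by (intro finite_pairs) auto
  obtain r where r: "r \<in> T 1"
    using ne by auto
  have "?a \<in> insert 1 (?f ` ?P)"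
    unfolding round_degree_def by (rule uInf_attained) (use fin in simp)
  moreover have "?f (1, r) \<le> 1"
    using Deg_mem[of r "T (1 + 1)"] by auto
  moreover have "(1, r) \<in> ?P"
    using r ne by auto
  ultimately obtain i s where s: "(i, s) \<in> ?P" "?f (i, s) \<le> ?a"
    by (metis (no_types, lifting) image_iff insert_iff order_refl surj_pair)
  then have "s \<notin> ?T i"
    using Vec_subset[of i k ?a "round_vec k ?a T"] by (auto simp: round_vec_def)
  moreover have "(SIGMA i:{1..k}. ?T i) \<subseteq> ?P"
    using Vec_subset[of _ k ?a "round_vec k ?a T"] by (fastforce simp: round_vec_def)
  ultimately have "(SIGMA i:{1..k}. ?T i) \<subset> ?P"
    using s by blast
  then show ?thesis
    unfolding potential_def val_loop_round using fin by (simp add: psubset_card_mono)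
qed

lemma loop_invar_run:
  assumes "u \<in> V" "v \<in> V" "1 \<le> k"
  shows "loop_invar k u v (val (run k u v n))"
proof (induction n)
  case (Suc n)
  then show ?case
    using loop_invar_round[OF assms(1,2) _ _ assms(3), of "fst (val (run k u v n))" "snd (val (run k u v n))"]
    by auto
qed (simp add: loop_invar_initial assms)

lemma run_subset:
  assumes "u \<in> V" "v \<in> V" "1 \<le> k" "1 \<le> i" "i \<le> k + 1"
  shows "snd (val (run k u v n)) i \<subseteq> V \<times> V"
  using loop_invar_subset[of k u v "fst (val (run k u v n))" "snd (val (run k u v n))"]
    loop_invar_run assms by simp

lemma rounds_bounded:
  assumes "u \<in> V" "v \<in> V" "1 \<le> k"
  shows "snd (val (run k u v n)) 1 = {} \<or> n + potential k (snd (val (run k u v n))) \<le> k * card V ^ 2"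
proof (induction n)
  case 0
  then show ?case
    using potential_le[of k "snd (val (run k u v 0))"] run_subset[OF assms, of _ 0] by auto
next
  case (Suc n)
  let ?T = "snd (val (run k u v n))"
  show ?case
  proof (cases "?T 1 = {(u, v)}")
    case True
    then have "potential k (snd (val (loop_round k ?T))) < potential k ?T"
      using run_subset[OF assms, of _ n] assms by (intro potential_round) auto
    then show ?thesis
      using True Suc by auto
  next
    case False
    then have "?T 1 = {}"
      using loop_invar_start loop_invar_run[OF assms, of n] by (metis prod.collapse)
    then show ?thesis
      by simp
  qed
qed

lemma returns_similarity_degree:
  assumes "u \<in> V" "v \<in> V" "1 \<le> k"
  shows "\<exists>a. returns k u v a \<and> is_similarity_degree k u v a"
proof -
  let ?n = "Suc (k * card V ^ 2)"
  obtain a T where aT: "val (run k u v ?n) = (a, T)"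
    by force
  then have "T 1 = {}"
    using rounds_bounded[OF assms, of ?n] by simp
  moreover have "loop_invar k u v (a, T)"
    using loop_invar_run[OF assms, of ?n] aT by simp
  ultimately show ?thesis
    unfolding returns_def using aT loop_invarD(6) by blast
qed

section \<open>The cost\<close>

abbreviation "m \<equiv> max_transitions V \<delta>"

lemma card_V_pos: "1 \<le> card V"
  using finite_V nonempty_V by (simp add: Suc_leI card_gt_0_iff)

lemma card_transitions: "card (transitions_from \<delta> x) \<le> m"
proof (cases "x \<in> V")
  case True
  then show ?thesis
    unfolding max_transitions_def using finite_V by (intro Max_ge) auto
next
  case False
  then have "transitions_from \<delta> x = {}"
    using transition_V by (auto simp: transitions_from_def)
  then show ?thesis
    by simp
qed

lemma card_transitions_label: "card {p. (x, \<tau>, p) \<in> \<delta>} \<le> m"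
proof -
  have "card {p. (x, \<tau>, p) \<in> \<delta>} = card (Pair \<tau> ` {p. (x, \<tau>, p) \<in> \<delta>})"
    by (simp add: card_image inj_on_def)
  also have "\<dots> \<le> card (transitions_from \<delta> x)"
    by (intro card_mono finite_transitions) (auto simp: transitions_from_def)
  finally show ?thesis
    using card_transitions[of x] by simp
qed

lemma cost_S_deg_alg:
  assumes "R \<subseteq> V \<times> V"
  shows "cost (S_deg_alg p q R) \<le> 6 * card V ^ 2"
proof -
  have "card (R `` {w}) \<le> card V" "card (R\<inverse> `` {w}) \<le> card V" for w
    using assms finite_V by (auto intro!: card_mono)
  then have "card (R `` {w}) + Suc (card (R\<inverse> `` {w}) + 2) \<le> 2 * card V + 3" for w
    using add_mono[of "card (R `` {w})" "card V" "card (R\<inverse> `` {w})" "card V"] by simp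
  then have "(\<Sum>w\<in>V. card (R `` {w}) + Suc (card (R\<inverse> `` {w}) + 2)) \<le> card V * (2 * card V + 3)"
    by (intro sum_cost_le) auto
  then have "cost (S_deg_alg p q R) \<le> card V * (2 * card V + 3) + card V"
    by (simp add: S_deg_alg_def)
  also have "\<dots> = 2 * card V ^ 2 + 4 * card V"
    by (simp add: power2_eq_square algebra_simps)
  also have "\<dots> \<le> 6 * card V ^ 2"
    using mult_le_mono[OF card_V_pos order_refl, of "card V"] by (simp add: power2_eq_square)
  finally show ?thesis .
qed

text \<open>The constant is \<open>6\<close> for the tabulated similarities plus \<open>5\<close> for the two nested
  minima and maxima and the final minimum, which cost at most \<open>2 m\<^sup>2 + 2 m + 1\<close>.\<close>

lemma cost_Deg:
  assumes "R \<subseteq> V \<times> V" "1 \<le> m"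
  shows "cost (Deg r R) \<le> 11 * (card V ^ 2 * m ^ 2)"
proof -
  obtain x y where r: "r = (x, y)"
    by force
  let ?P = "{(\<tau>, p, q). (x, \<tau>, p) \<in> \<delta> \<and> (y, \<tau>, q) \<in> \<delta>}"
  have "card ?P = card ((\<lambda>(\<tau>, p, q). ((\<tau>, p), (\<tau>, q))) ` ?P)"
    by (intro card_image[symmetric]) (auto simp: inj_on_def)
  also have "\<dots> \<le> card (transitions_from \<delta> x \<times> transitions_from \<delta> y)"
    by (intro card_mono finite_cartesian_product finite_transitions) (auto simp: transitions_from_def)
  also have "\<dots> \<le> m ^ 2"
    unfolding card_cartesian_product power2_eq_square by (intro mult_le_mono card_transitions)
  finally have P: "card ?P \<le> m ^ 2" .
  have X: "card {(\<tau>, p). (z, \<tau>, p) \<in> \<delta>} \<le> m" for z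
    using card_transitions[of z] by (simp add: transitions_from_def)
  have "cost (Deg r R) \<le> m ^ 2 * (6 * card V ^ 2) + ((m * m + m) + ((m * m + m) + 1))"
    unfolding r Deg_def prod.case timed_simps timed_family_simps
    by (intro add_mono sum_cost_le P X order_refl)
      (auto simp: cost_S_deg_alg assms card_transitions_label)
  also have "\<dots> \<le> m ^ 2 * (6 * card V ^ 2) + 5 * (m ^ 2 * 1)"
  proof -
    have "m \<le> m * m" "1 \<le> m * m"
      using assms(2) by auto
    then have "(m * m + m) + ((m * m + m) + 1) \<le> 5 * (m * m)"
      by linarith
    then show ?thesis
      by (simp add: power2_eq_square)
  qed
  also have "\<dots> \<le> m ^ 2 * (6 * card V ^ 2) + 5 * (m ^ 2 * card V ^ 2)"
    using card_V_pos by (intro add_mono mult_le_mono order_refl) simp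
  finally show ?thesis
    by (simp add: algebra_simps)
qed

text \<open>The factor \<open>12\<close> also covers the comparison that uses the degree.\<close>

abbreviation "dcost \<equiv> 12 * (card V ^ 2 * m ^ 2)"

lemma cost_Deg_compare:
  assumes "R \<subseteq> V \<times> V" "1 \<le> m"
  shows "cost (Deg r R) + 1 \<le> dcost"
proof -
  have "1 \<le> card V ^ 2 * m ^ 2"
    using assms(2) card_V_pos by simp
  then show ?thesis
    using cost_Deg[OF assms, of r] by linarith
qed

lemma cost_filter_Deg:
  assumes "S \<subseteq> V \<times> V" "R \<subseteq> V \<times> V" "1 \<le> m"
  shows "(\<Sum>r\<in>S. cost (Deg r R) + 1) \<le> card V ^ 2 * dcost"
  using assms by (intro sum_cost_le cost_Deg_compare card_pairs_le)

lemma cost_vec_loop: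
  assumes "1 \<le> m"
  shows "(\<And>j. 1 \<le> j \<Longrightarrow> j \<le> i \<Longrightarrow> C j \<subseteq> V \<times> V) \<Longrightarrow> A (i + 1) \<subseteq> V \<times> V \<Longrightarrow>
    cost (vec_loop a C i A) \<le> i * (card V ^ 2 * dcost)"
proof (induction i arbitrary: A)
  case (Suc i)
  define X where "X = {r \<in> C (Suc i). a \<le> val (Deg r (A (Suc i + 1)))}"
  have X: "X \<subseteq> V \<times> V"
    using Suc.prems(1)[of "Suc i"] by (auto simp: X_def)
  have "cost (vec_loop a C (Suc i) A)
      = (\<Sum>r\<in>C (Suc i). cost (Deg r (A (Suc i + 1))) + 1) + cost (vec_loop a C i (A(Suc i := X)))"
    by (simp add: X_def)
  also have "\<dots> \<le> card V ^ 2 * dcost + i * (card V ^ 2 * dcost)"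
    using Suc.prems X by (intro add_mono cost_filter_Deg Suc.IH assms) auto
  finally show ?case
    by simp
qed simp

lemma cost_Vec:
  assumes "1 \<le> m" "\<And>j. 1 \<le> j \<Longrightarrow> j \<le> k + 1 \<Longrightarrow> C j \<subseteq> V \<times> V"
  shows "cost (Vec k a C) \<le> k * (card V ^ 2 * dcost)"
  unfolding Vec_def using assms by (intro cost_vec_loop) auto

lemma cost_loop_round:
  assumes "1 \<le> m" "\<And>j. 1 \<le> j \<Longrightarrow> j \<le> k + 1 \<Longrightarrow> T j \<subseteq> V \<times> V"
  shows "cost (loop_round k T) \<le> 3 * (k * (card V ^ 2 * dcost))"
proof -
  let ?P = "SIGMA i:{1..k}. T i" and ?a = "round_degree k T"
  have "cost (loop_round k T) = ((\<Sum>(i, r)\<in>?P. cost (Deg r (T (i + 1)))) + card ?P) +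
      ((\<Sum>i\<in>{1..k}. \<Sum>r\<in>T i. cost (Deg r (T (i + 1))) + 1) + cost (Vec k ?a (round_vec k ?a T)))"
    by (simp add: loop_round_def round_degree_def round_vec_def case_prod_unfold cong: if_cong)
  moreover have "(\<Sum>(i, r)\<in>?P. cost (Deg r (T (i + 1)))) + card ?P
      = (\<Sum>(i, r)\<in>?P. cost (Deg r (T (i + 1))) + 1)"
    by (simp add: case_prod_unfold sum_Suc)
  moreover have "(\<Sum>(i, r)\<in>?P. cost (Deg r (T (i + 1))) + 1) \<le> (k * card V ^ 2) * dcost"
  proof (rule sum_cost_le)
    show "(case ir of (i, r) \<Rightarrow> cost (Deg r (T (i + 1))) + 1) \<le> dcost" if "ir \<in> ?P" for ir
      using that assms(2)[of "fst ir + 1"] cost_Deg_compare[OF _ assms(1)] by auto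
    show "card ?P \<le> k * card V ^ 2"
      using potential_le[of k T] assms(2) unfolding potential_def by simp
  qed
  moreover have "(\<Sum>i\<in>{1..k}. \<Sum>r\<in>T i. cost (Deg r (T (i + 1))) + 1) \<le> k * (card V ^ 2 * dcost)"
    by (intro sum_cost_le cost_filter_Deg) (use assms in auto)
  moreover have "cost (Vec k ?a (round_vec k ?a T)) \<le> k * (card V ^ 2 * dcost)"
    using assms by (intro cost_Vec) (auto simp: round_vec_def)
  ultimately show ?thesis
    unfolding mult.assoc[of k] by linarith
qed

lemma cost_layers: "cost (layers u k) \<le> k * (card V ^ 2 * m)"
proof (induction k)
  case (Suc k)
  have delta: "\<delta> = (SIGMA x:V. transitions_from \<delta> x)"
    using transition_V by (auto simp: transitions_from_def)
  have fin: "finite \<delta>"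
    using finite_V finite_transitions by (subst delta) auto
  have "card \<delta> = (\<Sum>x\<in>V. card (transitions_from \<delta> x))"
    using finite_V finite_transitions by (subst delta) simp
  also have "\<dots> \<le> card V * m"
    by (intro sum_cost_le card_transitions) simp
  finally have "card \<delta> \<le> card V * m" .
  then have "card {(x, \<tau>, p) \<in> \<delta>. x \<in> X} \<le> card V * m" for X
    by (rule order_trans[rotated]) (auto intro: card_mono fin)
  then have "card ({(x, \<tau>, p) \<in> \<delta>. x \<in> X} \<times> V) \<le> card V ^ 2 * m" for X
    using mult_le_mono1[of _ "card V * m" "card V"]
    by (simp add: card_cartesian_product power2_eq_square algebra_simps)
  then have "cost (next_layer X) \<le> card V ^ 2 * m" for X
    by (simp add: next_layer_def case_prod_unfold)
  then show ?case
    using add_mono[OF Suc, of "cost (next_layer (val (layers u k) k))" "card V ^ 2 * m"] by simp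
qed simp

lemma cost_initial_state:
  assumes "u \<in> V" "v \<in> V" "1 \<le> m"
  shows "cost (initial_state k u v) \<le> 2 * (k * (card V ^ 2 * m)) + k * (card V ^ 2 * dcost)"
proof -
  let ?C = "\<lambda>i. if i \<in> {1..k+1} then val (layers u k) (i - 1) \<times> val (layers v k) (i - 1) else {}"
  have "?C i \<subseteq> V \<times> V" if "1 \<le> i" "i \<le> k + 1" for i
    using that val_layers[of "i - 1" k] reach_subset assms by (auto; blast)
  then have "cost (Vec k 0 ?C) \<le> k * (card V ^ 2 * dcost)"
    by (intro cost_Vec assms) auto
  then show ?thesis
    using cost_layers[of u k] cost_layers[of v k] by (simp add: initial_state_def)
qed

text \<open>Each round is paid for by the pair that it deletes.\<close>

lemma cost_run:
  assumes "u \<in> V" "v \<in> V" "1 \<le> m" "1 \<le> k"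
  defines "D \<equiv> 3 * (k * (card V ^ 2 * dcost))"
  shows "cost (run k u v n) + D * potential k (snd (val (run k u v n)))
    \<le> cost (initial_state k u v) + D * (k * card V ^ 2)"
proof (induction n)
  case 0
  have "potential k (snd (val (run k u v 0))) \<le> k * card V ^ 2"
    using run_subset[OF assms(1,2,4), of _ 0] by (intro potential_le) auto
  then show ?case
    using mult_le_mono2 by simp
next
  case (Suc n)
  let ?T = "snd (val (run k u v n))" and ?s = "loop_round k (snd (val (run k u v n)))"
  show ?case
  proof (cases "?T 1 = {(u, v)}")
    case True
    have "cost ?s \<le> D"
      unfolding D_def using run_subset[OF assms(1,2,4), of _ n] by (intro cost_loop_round assms) auto
    moreover have "Suc (potential k (snd (val ?s))) \<le> potential k ?T"
      using run_subset[OF assms(1,2,4), of _ n] True assms(4) by (intro Suc_leI potential_round) auto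
    ultimately have "cost ?s + D * potential k (snd (val ?s)) \<le> D * potential k ?T"
      using mult_le_mono2[of "Suc (potential k (snd (val ?s)))" _ D] by fastforce
    then show ?thesis
      using True Suc by simp
  next
    case False
    then show ?thesis
      using Suc by simp
  qed
qed

text \<open>For \<open>k = 0\<close> the loop never ends, because there is no component from which \<open>(u, v)\<close> could be
  deleted, but its rounds are free.\<close>

lemma cost_run_zero:
  assumes "u \<in> V" "v \<in> V" "1 \<le> m"
  shows "cost (run 0 u v n) = 0"
proof (induction n)
  case 0
  then show ?case
    using cost_initial_state[OF assms, of 0] by simp
next
  case (Suc n)
  then show ?case
    by (simp add: loop_round_def Vec_def)
qed

lemma running_time_le:
  assumes "u \<in> V" "v \<in> V" "1 \<le> m"
  shows "running_time k u v \<le> enat (25 * (2 * k ^ 2 * card V ^ 6 * m ^ 2))"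
proof -
  have "cost (run k u v n) \<le> 25 * (2 * k ^ 2 * card V ^ 6 * m ^ 2)" for n
  proof (cases "k = 0")
    case True
    then show ?thesis
      using cost_run_zero[OF assms] by simp
  next
    case False
    then have k: "1 \<le> k"
      by simp
    let ?N = "k ^ 2 * card V ^ 6 * m ^ 2"
    have "cost (run k u v n) \<le> cost (initial_state k u v) + 3 * (k * (card V ^ 2 * dcost)) * (k * card V ^ 2)"
      using cost_run[OF assms k, of n] by linarith
    also have "3 * (k * (card V ^ 2 * dcost)) * (k * card V ^ 2) = 36 * ?N"
      by (simp add: power2_eq_square eval_nat_numeral algebra_simps)
    also have "cost (initial_state k u v) \<le> 2 * (k * (card V ^ 2 * m)) + k * (card V ^ 2 * dcost)"
      by (rule cost_initial_state[OF assms])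
    also have "k * (card V ^ 2 * dcost) = 12 * (k ^ 1 * card V ^ 4 * m ^ 2)"
      by (simp add: eval_nat_numeral algebra_simps)
    also have "k ^ 1 * card V ^ 4 * m ^ 2 \<le> ?N"
      using k card_V_pos by (intro mult_le_mono power_increasing order_refl) auto
    also have "k * (card V ^ 2 * m) = k ^ 1 * card V ^ 2 * m ^ 1"
      by simp
    also have "\<dots> \<le> ?N"
      using k card_V_pos assms(3) by (intro mult_le_mono power_increasing) auto
    finally show ?thesis
      by simp
  qed
  then show ?thesis
    unfolding running_time_def by (auto intro: SUP_least)
qed

end

theorem mainTheorem5:
  fixes tn :: "real \<Rightarrow> real \<Rightarrow> real"
  assumes "left_continuous_tnorm tn"
  shows "\<exists>c::nat. \<forall>(V::'v set) (L::'l set) (\<delta>::('v \<times> 'l \<times> ('v \<Rightarrow> real)) set) (u::'v) (v::'v) (k::nat).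
    finite_nfts tn V L \<delta> \<and> u \<in> V \<and> v \<in> V \<longrightarrow>
      (k \<ge> 1 \<longrightarrow>
        (\<exists>\<alpha>. finite_nfts.returns tn V \<delta> k u v \<alpha> \<and>
             finite_nfts.is_similarity_degree tn V L \<delta> k u v \<alpha>)) \<and>
      (max_transitions V \<delta> \<ge> 1 \<longrightarrow>
        finite_nfts.running_time tn V \<delta> k u v
          \<le> enat (c * (2 * k ^ 2 * card V ^ 6 * max_transitions V \<delta> ^ 2)))"
proof (rule exI[of _ 25], intro allI impI conjI; elim conjE)
  fix V :: "'v set" and L :: "'l set" and \<delta> :: "('v \<times> 'l \<times> ('v \<Rightarrow> real)) set" and u v :: 'v and k :: nat
  assume "finite_nfts tn V L \<delta>" and uv: "u \<in> V" "v \<in> V"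
  then interpret finite_nfts tn V L \<delta>
    by simp
  show "\<exists>\<alpha>. returns k u v \<alpha> \<and> is_similarity_degree k u v \<alpha>" if "k \<ge> 1"
    using returns_similarity_degree[OF uv that] .
  show "running_time k u v \<le> enat (25 * (2 * k ^ 2 * card V ^ 6 * max_transitions V \<delta> ^ 2))"
    if "max_transitions V \<delta> \<ge> 1"
    using running_time_le[OF uv that] .
qed

end
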